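(* Let $d$ be a nonnegative integer. If $\mathcal F$ is a $d$-degenerate minor-closed family of graphs, then every graph $G$ in $\mathcal F$ is conflict-free $(2d+1)$-choosable.
   Context: All graphs are finite and simple. A graph is $d$-degenerate if every subgraph of it has a vertex of degree at most $d$; a class is $d$-degenerate if all its members are. A class is minor-closed if every minor of a member is a member. For a real number $k$, a $k$-list-assignment of $G$ assigns to each vertex $v$ a set $L(v)$ with $|L(v)|\ge k$; an $L$-coloring $\phi$ has $\phi(v)\in L(v)$ for all $v$; it is proper if adjacent vertices get different colors; it is conflict-free if for every vertex $v$ with $N_G(v)\ne\emptyset$ there is a color appearing exactly once on $N_G(v)$ (the open neighbourhood). $G$ is conflict-free $k$-choosable if for every $k$-list-assignment $L$ of $G$ there exists a proper conflict-free $L$-coloring of $G$. *)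

theory Defs
  imports Complex_Main "Graph_Theory.Graph_Theory"
begin

text \<open>
  Finite simple graphs are the symmetric loop-free finite digraphs \<^locale>\<open>pair_graph\<close>: an edge
  between \<open>u\<close> and \<open>v\<close> is the pair of arcs \<open>(u, v)\<close>, \<open>(v, u)\<close>. The graph without vertices is
  included.
\<close>

definition neighborhood :: "'a pair_pre_digraph \<Rightarrow> 'a \<Rightarrow> 'a set" where
  "neighborhood G v = {u. (v, u) \<in> parcs G}"

definition degree :: "'a pair_pre_digraph \<Rightarrow> 'a \<Rightarrow> nat" where
  "degree G v = card (neighborhood G v)"

text \<open>
  The library's \<^const>\<open>subgraph\<close> admits non-symmetric subdigraphs, hence the condition that \<open>H\<close> is
  again a graph. The graph without vertices has no vertex of any degree and is excluded.
\<close>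

definition degenerate :: "nat \<Rightarrow> 'a pair_pre_digraph \<Rightarrow> bool" where
  "degenerate d G \<longleftrightarrow>
     (\<forall>H :: 'a pair_pre_digraph.
        pair_graph H \<and> subgraph (with_proj H) (with_proj G) \<and> pverts H \<noteq> {} \<longrightarrow>
        (\<exists>v\<in>pverts H. degree H v \<le> d))"

text \<open>
  \<open>H\<close> is isomorphic to a graph obtained from \<open>G\<close> by vertex deletions, edge deletions and edge
  contractions: \<open>B x\<close> is the set of vertices of \<open>G\<close> contracted to the vertex \<open>x\<close> of \<open>H\<close>.
  Connectedness includes nonemptiness. A minor of \<open>G\<close> has at most as many vertices as \<open>G\<close>, so
  every minor has an isomorphic copy with vertices in the vertex type of \<open>G\<close>.
\<close>

definition minor :: "'a pair_pre_digraph \<Rightarrow> 'a pair_pre_digraph \<Rightarrow> bool" where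
  "minor H G \<longleftrightarrow> pair_graph H \<and>
     (\<exists>B :: 'a \<Rightarrow> 'a set.
        (\<forall>x\<in>pverts H. B x \<subseteq> pverts G \<and> Digraph_Component.connected (with_proj G \<restriction> B x)) \<and>
        (\<forall>x\<in>pverts H. \<forall>y\<in>pverts H. x \<noteq> y \<longrightarrow> B x \<inter> B y = {}) \<and>
        (\<forall>(x, y)\<in>parcs H. \<exists>u\<in>B x. \<exists>v\<in>B y. (u, v) \<in> parcs G))"

definition minor_closed :: "'a pair_pre_digraph set \<Rightarrow> bool" where
  "minor_closed F \<longleftrightarrow> (\<forall>G\<in>F. \<forall>H. minor H G \<longrightarrow> H \<in> F)"

text \<open>Lists may be infinite; since \<^const>\<open>card\<close> is 0 on infinite sets, that case is separate.\<close>

definition list_assignment :: "real \<Rightarrow> 'a pair_pre_digraph \<Rightarrow> ('a \<Rightarrow> 'c set) \<Rightarrow> bool" where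
  "list_assignment k G L \<longleftrightarrow> (\<forall>v\<in>pverts G. infinite (L v) \<or> real (card (L v)) \<ge> k)"

definition list_coloring ::
  "'a pair_pre_digraph \<Rightarrow> ('a \<Rightarrow> 'c set) \<Rightarrow> ('a \<Rightarrow> 'c) \<Rightarrow> bool" where
  "list_coloring G L \<phi> \<longleftrightarrow> (\<forall>v\<in>pverts G. \<phi> v \<in> L v)"

definition proper_coloring :: "'a pair_pre_digraph \<Rightarrow> ('a \<Rightarrow> 'c) \<Rightarrow> bool" where
  "proper_coloring G \<phi> \<longleftrightarrow> (\<forall>(u, v)\<in>parcs G. \<phi> u \<noteq> \<phi> v)"

definition conflict_free :: "'a pair_pre_digraph \<Rightarrow> ('a \<Rightarrow> 'c) \<Rightarrow> bool" where
  "conflict_free G \<phi> \<longleftrightarrow>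
     (\<forall>v\<in>pverts G. neighborhood G v \<noteq> {} \<longrightarrow> (\<exists>c. \<exists>!u. u \<in> neighborhood G v \<and> \<phi> u = c))"

text \<open>The type argument is the universe from which the colors in the lists are taken.\<close>

definition conflict_free_choosable ::
  "'c itself \<Rightarrow> real \<Rightarrow> 'a pair_pre_digraph \<Rightarrow> bool" where
  "conflict_free_choosable _ k G \<longleftrightarrow>
     (\<forall>L :: 'a \<Rightarrow> 'c set. list_assignment k G L \<longrightarrow>
        (\<exists>\<phi>. list_coloring G L \<phi> \<and> proper_coloring G \<phi> \<and> conflict_free G \<phi>))"

end

theory Submission
  imports Defs
begin

text \<open>
  The proof is an induction on the number of vertices in which the two requirements are decoupled:
  the coloring is proper on \<open>G\<close>, but conflict-free only on a given spanning subgraph \<open>H\<close> of \<open>G\<close>.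
  Let \<open>v\<close> be a vertex of degree at most \<open>d\<close> in \<open>G\<close>. Contract \<open>v\<close> into a neighbor \<open>u\<close> in \<open>G\<close>, chosen
  to be a neighbor in \<open>H\<close> if there is one, but merely delete \<open>v\<close> from \<open>H\<close>, and color by induction.
  In the contracted graph \<open>u\<close> is adjacent to all other neighbors of \<open>v\<close>, so its color occurs exactly
  once around \<open>v\<close>. Now color \<open>v\<close>, avoiding for each of its at most \<open>d\<close> neighbors \<open>w\<close> the color of \<open>w\<close>
  and a color that occurs exactly once around \<open>w\<close> in \<open>H - v\<close>; one of \<open>2 d + 1\<close> colors is left.
\<close>

definition delete_vertex :: "'a pair_pre_digraph \<Rightarrow> 'a \<Rightarrow> 'a pair_pre_digraph" where
  "delete_vertex G v = \<lparr>pverts = pverts G - {v}, parcs = {(x, y) \<in> parcs G. x \<noteq> v \<and> y \<noteq> v}\<rparr>"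

text \<open>If \<open>v\<close> is isolated, this only deletes \<open>v\<close>, whatever \<open>u\<close> is.\<close>

definition contract_into :: "'a pair_pre_digraph \<Rightarrow> 'a \<Rightarrow> 'a \<Rightarrow> 'a pair_pre_digraph" where
  "contract_into G v u =
     \<lparr>pverts = pverts G - {v},
      parcs = {(x, y) \<in> parcs G. x \<noteq> v \<and> y \<noteq> v} \<union>
        (\<Union>y\<in>neighborhood G v - {u}. {(u, y), (y, u)})\<rparr>"

lemma neighborhood_delete_vertex:
  "w \<noteq> v \<Longrightarrow> neighborhood (delete_vertex G v) w = neighborhood G w - {v}"
  by (auto simp: neighborhood_def delete_vertex_def)

lemma pair_graph_contract_into:
  assumes "pair_graph G" and "neighborhood G v = {} \<or> u \<in> neighborhood G v"
  shows "pair_graph (contract_into G v u)"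
proof -
  interpret pair_graph G by fact
  let ?C = "contract_into G v u"
  have loopfree: "(x, x) \<notin> parcs G" for x
    using no_loops' by blast
  have arcs: "fst e \<in> pverts ?C" "snd e \<in> pverts ?C" "fst e \<noteq> snd e" if "e \<in> parcs ?C" for e
    using that assms(2)
    by (auto simp: contract_into_def neighborhood_def loopfree dest: wellformed')
  have verts: "finite (pverts ?C)"
    using pair_finite_verts by (simp add: contract_into_def)
  have "parcs ?C \<subseteq> pverts ?C \<times> pverts ?C"
    using arcs by (auto simp: mem_Times_iff)
  then have "finite (parcs ?C)"
    using verts by (meson finite_SigmaI finite_subset)
  moreover have "symmetric (with_proj ?C)"
    unfolding symmetric_def
    by (rule symI) (auto simp: contract_into_def intro: arcs_symmetric)
  ultimately show ?thesis
    by unfold_locales (simp_all add: arcs verts)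
qed

text \<open>These are the branch sets that arise when one edge is contracted: the disjunct
  \<open>a = b\<close> makes \<open>{a, b}\<close> a singleton.\<close>

lemma connected_induce_pair:
  assumes "a = b \<or> (a, b) \<in> parcs G"
  shows "Digraph_Component.connected (with_proj G \<restriction> {a, b})"
proof -
  let ?S = "mk_symmetric (with_proj G \<restriction> {a, b})"
  have S: "parcs ?S \<supseteq> {(a, b), (b, a)} - Id" "pverts ?S = {a, b}"
    using assms by (auto simp: parcs_mk_symmetric)
  have "(x, y) \<in> rtrancl_on (pverts ?S) (parcs ?S)" if "x \<in> {a, b}" "y \<in> {a, b}" for x y
  proof (cases "x = y")
    case True
    then show ?thesis using that S(2) by simp
  next
    case False
    then have "(x, y) \<in> parcs ?S" using that S(1) by blast
    then show ?thesis
      using that S(2) by (intro rtrancl_on_into_rtrancl_on[OF rtrancl_on_refl]) auto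
  qed
  then show ?thesis
    by (auto simp: connected_def strongly_connected_def reachable_def)
qed

lemma minor_contract_into:
  assumes G: "pair_graph G" and v: "v \<in> pverts G"
    and u: "neighborhood G v = {} \<or> u \<in> neighborhood G v"
  shows "minor (contract_into G v u) G"
proof -
  interpret pair_graph G by fact
  \<comment> \<open>The guard is for an isolated \<open>v\<close>: then all branch sets are
    singletons and no remaining vertex absorbs \<open>v\<close>, so \<open>v\<close> is
    deleted.\<close>
  define B where "B = (\<lambda>x. if x = u \<and> (u, v) \<in> parcs G then {u, v} else {x})"
  have uv: "(u, v) \<in> parcs G" if "(v, y) \<in> parcs G" for y
    using u that arcs_symmetric by (auto simp: neighborhood_def)
  have "B x \<subseteq> pverts G \<and> Digraph_Component.connected (with_proj G \<restriction> B x)"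
    if "x \<in> pverts (contract_into G v u)" for x
    using that v connected_induce_pair[of x x G]
    by (auto simp: B_def contract_into_def intro: connected_induce_pair)
  moreover have "B x \<inter> B y = {}"
    if "x \<in> pverts (contract_into G v u)" "y \<in> pverts (contract_into G v u)" "x \<noteq> y" for x y
    using that by (auto simp: B_def contract_into_def)
  \<comment> \<open>A new arc between \<open>u\<close> and \<open>y\<close> stems from the one
    between \<open>v\<close> and \<open>y\<close>, since \<open>uv\<close> puts \<open>v\<close>
    into \<open>B u\<close>.\<close>
  moreover have "\<exists>a\<in>B x. \<exists>b\<in>B y. (a, b) \<in> parcs G"
    if "(x, y) \<in> parcs (contract_into G v u)" for x y
    using that uv arcs_symmetric
    by (auto simp: B_def contract_into_def neighborhood_def)
  ultimately show ?thesis
    unfolding minor_def using pair_graph_contract_into[OF G u]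
    by (intro conjI exI[of _ B] ballI impI) auto
qed

lemma list_assignment_obtain:
  assumes "list_assignment (2 * real d + 1) G L" and "v \<in> pverts G"
    and "finite X" and "card X \<le> 2 * d"
  obtains c where "c \<in> L v" and "c \<notin> X"
proof -
  have "\<not> L v \<subseteq> X"
  proof
    assume sub: "L v \<subseteq> X"
    \<comment> \<open>This rules out the infinite case of \<open>list_assignment\<close>, leaving at
      least \<open>2 * d + 1\<close> colors.\<close>
    then have "finite (L v)" using assms(3) finite_subset by blast
    moreover have "card (L v) \<le> 2 * d" using card_mono[OF assms(3) sub] assms(4) by simp
    ultimately show False
      using assms(1,2) by (fastforce simp: list_assignment_def)
  qed
  then show thesis using that by blast
qed

lemma extend_proper_conflict_free:
  assumes G: "pair_graph G" and v: "v \<in> pverts G" and deg: "degree G v \<le> d"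
    and H: "pverts H = pverts G" "parcs H \<subseteq> parcs G"
    and u: "neighborhood H v = {} \<or> u \<in> neighborhood H v"
    and L: "list_assignment (2 * real d + 1) G L"
    and list: "list_coloring (contract_into G v u) L \<phi>"
    and proper: "proper_coloring (contract_into G v u) \<phi>"
    and cf: "conflict_free (delete_vertex H v) \<phi>"
  shows "\<exists>\<psi>. list_coloring G L \<psi> \<and> proper_coloring G \<psi> \<and> conflict_free H \<psi>"
proof -
  interpret pair_graph G by fact
  define N where "N = neighborhood G v"
  have fin: "finite N"
    unfolding N_def
    by (rule finite_subset[OF _ pair_finite_verts]) (auto simp: neighborhood_def dest: wellformed')
  \<comment> \<open>The existential stands outside the implication so that choice yields one
    function \<open>f\<close>; its value is arbitrary where \<open>w\<close> has no neighbor in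
    \<open>H\<close> besides \<open>v\<close>.\<close>
  have "\<forall>w\<in>pverts G - {v}. \<exists>c. neighborhood H w - {v} \<noteq> {} \<longrightarrow>
      (\<exists>!x. x \<in> neighborhood H w - {v} \<and> \<phi> x = c)"
  proof
    fix w assume "w \<in> pverts G - {v}"
    then have "neighborhood H w - {v} \<noteq> {} \<longrightarrow>
        (\<exists>c. \<exists>!x. x \<in> neighborhood H w - {v} \<and> \<phi> x = c)"
      using bspec[OF cf[unfolded conflict_free_def], of w] H(1) neighborhood_delete_vertex[of w v H]
      by (simp add: delete_vertex_def)
    then show "\<exists>c. neighborhood H w - {v} \<noteq> {} \<longrightarrow>
        (\<exists>!x. x \<in> neighborhood H w - {v} \<and> \<phi> x = c)"
      by (simp only: ex_simps)
  qed
  from bchoice[OF this] obtain f where f: "\<forall>w\<in>pverts G - {v}. neighborhood H w - {v} \<noteq> {} \<longrightarrow>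
      (\<exists>!x. x \<in> neighborhood H w - {v} \<and> \<phi> x = f w)" ..
  have "card (\<phi> ` N \<union> f ` N) \<le> 2 * d"
    using card_Un_le[of "\<phi> ` N" "f ` N"] card_image_le[OF fin, of \<phi>] card_image_le[OF fin, of f]
      deg by (simp add: degree_def N_def)
  then obtain c where c: "c \<in> L v" "c \<notin> \<phi> ` N \<union> f ` N"
    using list_assignment_obtain[OF L v, of "\<phi> ` N \<union> f ` N"] fin by auto
  let ?\<psi> = "\<phi>(v := c)"
  have "list_coloring G L ?\<psi>"
    using list c(1) by (auto simp: list_coloring_def contract_into_def)
  moreover have "proper_coloring G ?\<psi>"
    unfolding proper_coloring_def
  proof clarify
    fix x y assume xy: "(x, y) \<in> parcs G" and eq: "?\<psi> x = ?\<psi> y"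
    have "x \<noteq> y" using xy no_loops' by blast
    moreover have "\<phi> x \<noteq> \<phi> y" if "x \<noteq> v" "y \<noteq> v"
      using proper xy that by (auto simp: proper_coloring_def contract_into_def)
    moreover have "y \<in> N" if "x = v" using xy that by (simp add: N_def neighborhood_def)
    moreover have "x \<in> N" if "y = v"
      using xy that arcs_symmetric by (simp add: N_def neighborhood_def)
    ultimately show False using eq c(2) by (auto split: if_splits)
  qed
  moreover have "conflict_free H ?\<psi>"
    unfolding conflict_free_def
  proof (intro ballI impI)
    fix w assume w: "w \<in> pverts H" and ne: "neighborhood H w \<noteq> {}"
    show "\<exists>c. \<exists>!x. x \<in> neighborhood H w \<and> ?\<psi> x = c"
    proof (cases "w = v")
      case True
      with u ne have uH: "u \<in> neighborhood H v" by simp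
      have "\<phi> x \<noteq> \<phi> u" if "x \<in> neighborhood H v" "x \<noteq> u" for x
        using that H(2) proper
        by (auto simp: proper_coloring_def contract_into_def neighborhood_def)
      moreover have "v \<notin> neighborhood H v"
        using H(2) no_loops' by (auto simp: neighborhood_def)
      ultimately have "\<exists>!x. x \<in> neighborhood H w \<and> ?\<psi> x = \<phi> u"
        using uH True by (intro ex1I[of _ u]) (auto split: if_splits)
      then show ?thesis ..
    next
      case False
      show ?thesis
      proof (cases "neighborhood H w \<subseteq> {v}")
        \<comment> \<open>Here \<open>f w\<close> carries no information, but the color of a sole
          neighbor is always unique.\<close>
        case True
        then have "neighborhood H w = {v}" using ne by blast
        then show ?thesis by auto
      next
        case nsub: False
        then obtain x where x: "x \<in> neighborhood H w - {v}" "\<phi> x = f w"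
          and uniq: "\<And>y. y \<in> neighborhood H w - {v} \<Longrightarrow> \<phi> y = f w \<Longrightarrow> y = x"
          using bspec[OF f, of w] w H(1) False by blast
        \<comment> \<open>If \<open>v\<close> is not in \<open>neighborhood H w\<close>, the colors
          around \<open>w\<close> are still those of \<open>\<phi>\<close>; otherwise
          \<open>v\<close> must not repeat the color \<open>f w\<close> of \<open>x\<close>.\<close>
        have "c \<noteq> f w" if "v \<in> neighborhood H w"
        proof -
          have "w \<in> N" using that H(2) arcs_symmetric by (auto simp: N_def neighborhood_def)
          then show ?thesis using c(2) by blast
        qed
        then have "\<exists>!x. x \<in> neighborhood H w \<and> ?\<psi> x = f w"
          using x by (intro ex1I[of _ x]) (auto split: if_splits intro: uniq)
        then show ?thesis ..
      qed
    qed
  qed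
  ultimately show ?thesis by blast
qed

text \<open>Induction with \<open>H = G\<close> alone would fail: the color occurring once around
  \<open>w\<close> in the contracted graph might sit on a vertex that becomes adjacent to
  \<open>w\<close> only by the contraction.\<close>

lemma proper_conflict_free_on_spanning_subgraph:
  assumes graphs: "\<forall>G\<in>F. pair_graph G"
    and degen: "\<forall>G\<in>F. degenerate d G"
    and closed: "minor_closed F"
    and "G \<in> F" and "pverts H = pverts G" and "parcs H \<subseteq> parcs G"
    and "list_assignment (2 * real d + 1) G L"
  shows "\<exists>\<phi>. list_coloring G L \<phi> \<and> proper_coloring G \<phi> \<and> conflict_free H \<phi>"
  using assms(4-)
proof (induction "card (pverts G)" arbitrary: G H rule: less_induct)
  case less
  interpret pair_graph G using graphs less.prems(1) by blast
  show ?case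
  proof (cases "pverts G = {}")
    case True
    then have "parcs G = {}" using wellformed' by auto
    with True less.prems(2) show ?thesis
      by (simp add: list_coloring_def proper_coloring_def conflict_free_def)
  next
    case False
    \<comment> \<open>Degeneracy is applied to \<open>G\<close> as a subgraph of itself.\<close>
    have "subgraph (with_proj G) (with_proj G)" by (rule subgraph_refl)
    then obtain v where v: "v \<in> pverts G" and deg: "degree G v \<le> d"
      using degen less.prems(1) pair_graph False unfolding degenerate_def by blast
    have "neighborhood H v \<subseteq> neighborhood G v"
      using less.prems(3) by (auto simp: neighborhood_def)
    \<comment> \<open>By the inclusion, a neighbor of \<open>v\<close> in \<open>H\<close> serves
      both conditions; failing that, any neighbor in \<open>G\<close> does, and if \<open>v\<close>
      is isolated in \<open>G\<close>, any \<open>u\<close>.\<close>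
    then obtain u where uG: "neighborhood G v = {} \<or> u \<in> neighborhood G v"
      and uH: "neighborhood H v = {} \<or> u \<in> neighborhood H v"
      by blast
    let ?G = "contract_into G v u" and ?H = "delete_vertex H v"
    have "?G \<in> F"
      using minor_contract_into[OF pair_graph v uG] closed less.prems(1)
      by (auto simp: minor_closed_def)
    moreover have "card (pverts ?G) < card (pverts G)"
      using v pair_finite_verts by (simp add: contract_into_def card_Diff1_less del: card_Diff_insert)
    moreover have "pverts ?H = pverts ?G" "parcs ?H \<subseteq> parcs ?G"
      using less.prems(2,3) by (auto simp: contract_into_def delete_vertex_def)
    moreover have "list_assignment (2 * real d + 1) ?G L"
      using less.prems(4) by (simp add: list_assignment_def contract_into_def)
    ultimately obtain \<phi> where "list_coloring ?G L \<phi>" "proper_coloring ?G \<phi>" "conflict_free ?H \<phi>"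
      using less.hyps[of ?G ?H] by blast
    then show ?thesis
      using extend_proper_conflict_free[OF pair_graph v deg less.prems(2,3) uH less.prems(4)] by blast
  qed
qed

theorem theorem1p4:
  fixes d :: nat and F :: "'a pair_pre_digraph set"
  assumes "\<forall>G\<in>F. pair_graph G"
    and "\<forall>G\<in>F. degenerate d G"
    and "minor_closed F"
  shows "\<forall>G\<in>F. conflict_free_choosable TYPE('c) (2 * real d + 1) G"
  unfolding conflict_free_choosable_def
proof (intro ballI allI impI)
  fix G and L :: "'a \<Rightarrow> 'c set"
  assume "G \<in> F" and "list_assignment (2 * real d + 1) G L"
  then show "\<exists>\<phi>. list_coloring G L \<phi> \<and> proper_coloring G \<phi> \<and> conflict_free G \<phi>"
    by (rule proper_conflict_free_on_spanning_subgraph[OF assms _ refl subset_refl])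
qed

end
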